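(* Let $\mathcal H$ be a real Hilbert space, $C\subseteq\mathcal H$ nonempty closed convex, and let $B\colon\mathcal H\to\mathcal H$ be monotone and $L$-Lipschitz ($L>0$). Put $\lambda=\tfrac1{5L}$. Assume $S=\{x^\star\}$ and that for some $c>0$ $$\operatorname{dist}(x,S)\le c\,\bigl\|x-P_C\bigl(x-\lambda B(x)\bigr)\bigr\|\qquad\forall x\in C.$$ Let $(\beta_k)$ satisfy $0\le\beta_k\le\tfrac14$, $\sum_k\beta_k<\infty$, set $\theta_k=1-\beta_k$, fix $x_{-1}=x_0=u_0\in C$, and define $$x_{k+1}=P_C\bigl(x_k-\lambda B(u_k)\bigr)\quad(k\ge0),\qquad u_k=x_k+\theta_k(x_k-x_{k-1})+\beta_k(x_k-u_{k-1})\quad(k\ge1).$$ Then $(x_k)$ converges strongly to $x^\star$. Writing $V_k:=\|x_k-P_C(x_k-\lambda B(x_k))\|$, $r_k:=\|x_k-x^\star\|$, $\epsilon_k:=25\lambda L\beta_k$, and $A:=\sup_ka_k<\infty$ for the Lyapunov sequence $(a_k)$ defined in the context, one has for all $k$ $$\sum_{j\ge k}V_j^2\le90\Bigl(a_k+A\sum_{j\ge k}\epsilon_j\Bigr)\qquad\text{and}\qquad r_k\le cV_k,$$ so $\sum_{j\ge k}\operatorname{dist}^2(x_j,S)=O\bigl(a_k+\sum_{j\ge k}\epsilon_j\bigr)$. If additionally the filter decays geometrically, $\beta_k=O(\eta^k)$ with $\eta\in(0,1)$, the tail estimate holds with $\sum_{j\ge k}\epsilon_j=O(\eta^k)$.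
   Context: $P_C$ is the metric projection onto $C$; $S=\{z\in C:\langle B(z),x-z\rangle\ge0\ \forall x\in C\}$; monotone means $\langle B(x)-B(y),x-y\rangle\ge0$ for all $x,y\in\mathcal H$. Lyapunov sequence: with the convention $u_{-1}=x_0$, $$a_k=\|x_k-x^\star\|^2+2\lambda L\|x_k-u_{k-1}\|^2+2\lambda\langle B(x^\star),x_{k-1}-x^\star\rangle+\tfrac13\|u_{k-1}-x_{k-1}\|^2,$$ where for $k=0$ the last term is $0$. *)

theory Defs
  imports "HOL-Analysis.Analysis" "HOL-Library.Landau_Symbols"
begin

text \<open>
  A real Hilbert space is a type of sort \<open>{real_inner, complete_space}\<close>. The library's
  \<open>closest_point\<close> requires sort \<open>heine_borel\<close>, i.e. finite dimension, so the metric
  projection is defined here. For nonempty closed convex \<open>C\<close> the minimiser exists and is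
  unique, which makes the definite description meaningful.
\<close>

definition metric_proj :: "'a::real_inner set \<Rightarrow> 'a \<Rightarrow> 'a" where
  "metric_proj C y = (THE p. p \<in> C \<and> (\<forall>q\<in>C. norm (y - p) \<le> norm (y - q)))"

definition monotone_operator :: "('a::real_inner \<Rightarrow> 'a) \<Rightarrow> bool" where
  "monotone_operator B \<longleftrightarrow> (\<forall>x y. inner (B x - B y) (x - y) \<ge> 0)"

definition vi_solutions :: "'a::real_inner set \<Rightarrow> ('a \<Rightarrow> 'a) \<Rightarrow> 'a set" where
  "vi_solutions C B = {z \<in> C. \<forall>x\<in>C. inner (B z) (x - z) \<ge> 0}"

text \<open>
  \<open>prev s0 s k\<close> is the term with index \<open>k - 1\<close> of the sequence \<open>s\<close> started at index \<open>-1\<close>,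
  where \<open>s0\<close> is the term with index \<open>-1\<close>.
\<close>

definition prev :: "'a \<Rightarrow> (nat \<Rightarrow> 'a) \<Rightarrow> nat \<Rightarrow> 'a" where
  "prev s0 s k = (case k of 0 \<Rightarrow> s0 | Suc j \<Rightarrow> s j)"

text \<open>
  In the Lyapunov sequence both starting terms \<open>x\<^sub>-\<^sub>1\<close> and \<open>u\<^sub>-\<^sub>1\<close> are
  \<open>x 0\<close>; in particular the last summand vanishes for \<open>k = 0\<close>.
\<close>

definition lyapunov ::
  "('a::real_inner \<Rightarrow> 'a) \<Rightarrow> real \<Rightarrow> real \<Rightarrow> 'a \<Rightarrow> (nat \<Rightarrow> 'a) \<Rightarrow> (nat \<Rightarrow> 'a) \<Rightarrow> nat \<Rightarrow> real" where
  "lyapunov B L lam xs x u k =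
     (norm (x k - xs))\<^sup>2
     + 2 * lam * L * (norm (x k - prev (x 0) u k))\<^sup>2
     + 2 * lam * inner (B xs) (prev (x 0) x k - xs)
     + 1 / 3 * (norm (prev (x 0) u k - prev (x 0) x k))\<^sup>2"

end

theory Submission
  imports Defs "HOL-Real_Asymp.Real_Asymp"
begin

text \<open>
  Since \<open>u\<^sub>k = 2 x\<^sub>k - x\<^sub>k\<^sub>-\<^sub>1 - \<beta>\<^sub>k (u\<^sub>k\<^sub>-\<^sub>1 - x\<^sub>k\<^sub>-\<^sub>1)\<close>, the iteration is Malitsky's projected
  reflected gradient method up to a filter term. Apart from cross terms absorbed
  by a positive quadratic form, that term enters his energy estimate only through \<open>\<langle>B u\<^sub>k\<^sub>-\<^sub>1 - B x\<^sup>\<star>, u\<^sub>k\<^sub>-\<^sub>1 - x\<^sub>k\<^sub>-\<^sub>1\<rangle>\<close>, which the Lyapunov value \<open>a\<^sub>k\<close> controls. For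
  \<open>k \<ge> 1\<close> this gives \<open>a\<^sub>k\<^sub>+\<^sub>1 + \<delta>\<^sub>k \<le> (1 + \<epsilon>\<^sub>k) a\<^sub>k\<close> with
  \<open>\<delta>\<^sub>k = (\<parallel>u\<^sub>k - x\<^sub>k\<parallel>\<^sup>2 + \<parallel>x\<^sub>k\<^sub>+\<^sub>1 - u\<^sub>k\<parallel>\<^sup>2) / 20\<close> and \<open>V\<^sub>k\<^sup>2 \<le> 49 \<delta>\<^sub>k\<close>, and telescoping yields the tail
  bound with 49 in place of 90. At \<open>k = 0\<close> the decrease is not available, because \<open>x\<^sub>0\<close> is not the result
  of a projection step; the gap between 49 and 90 absorbs this first step.
\<close>

section \<open>The metric projection in a real Hilbert space\<close>

text \<open>The midpoint of two near-minimisers lies in \<open>C\<close> by convexity, so its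
  distance to \<open>y\<close> is at least \<open>D\<close>; the parallelogram law then bounds their
  separation. The minimising sequence is therefore Cauchy, and completeness gives a limit, in
  \<open>C\<close> by closedness.\<close>

lemma metric_proj_exists:
  fixes C :: "'a::{real_inner, complete_space} set"
  assumes C: "C \<noteq> {}" "closed C" "convex C"
  shows "\<exists>p\<in>C. \<forall>q\<in>C. dist y p \<le> dist y q"
proof -
  define D where "D = infdist y C"
  have D0: "D \<ge> 0" by (simp add: D_def infdist_nonneg)
  have low: "D \<le> dist y q" if "q \<in> C" for q
    using that by (simp add: D_def infdist_le)
  have "\<exists>p\<in>C. dist y p < D + 1 / (real n + 1)" for n
  proof (rule ccontr)
    assume "\<not> ?thesis"
    then have "D + 1 / (real n + 1) \<le> D"
      unfolding D_def infdist_notempty[OF C(1)]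
      by (intro cINF_greatest[OF C(1)]) (auto simp: infdist_notempty[OF C(1)])
    then show False by (simp add: field_simps)
  qed
  then obtain p where p: "\<And>n. p n \<in> C" "\<And>n. dist y (p n) < D + 1 / (real n + 1)"
    by metis
  have gap: "(dist (p m) (p n))\<^sup>2 \<le> 4 * ((D + e)\<^sup>2 - D\<^sup>2)"
    if "dist y (p m) \<le> D + e" "dist y (p n) \<le> D + e" for m n e
  proof -
    have "(1/2) *\<^sub>R p m + (1/2) *\<^sub>R p n \<in> C"
      using C(3) p(1) by (intro convexD) auto
    from power_mono[OF low[OF this] D0, of 2]
    have "D\<^sup>2 \<le> (norm (y - ((1/2) *\<^sub>R p m + (1/2) *\<^sub>R p n)))\<^sup>2" by (simp add: dist_norm)
    moreover have "(dist (p m) (p n))\<^sup>2 + 4 * (norm (y - ((1/2) *\<^sub>R p m + (1/2) *\<^sub>R p n)))\<^sup>2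
        = 2 * (dist y (p m))\<^sup>2 + 2 * (dist y (p n))\<^sup>2"
      unfolding dist_norm power2_norm_eq_inner
      by (simp add: inner_diff_left inner_diff_right inner_add_left inner_add_right inner_commute
          algebra_simps)
    moreover have "(dist y (p m))\<^sup>2 \<le> (D + e)\<^sup>2" "(dist y (p n))\<^sup>2 \<le> (D + e)\<^sup>2"
      using that by (auto intro: power_mono)
    ultimately show ?thesis by (simp add: algebra_simps)
  qed
  have small: "(\<lambda>n. 1 / (real n + 1)) \<longlonglongrightarrow> 0"
    by real_asymp
  have "(\<lambda>n. 4 * ((D + 1 / (real n + 1))\<^sup>2 - D\<^sup>2)) \<longlonglongrightarrow> 4 * ((D + 0)\<^sup>2 - D\<^sup>2)"
    by (intro tendsto_intros small)
  then have lim: "(\<lambda>n. 4 * ((D + 1 / (real n + 1))\<^sup>2 - D\<^sup>2)) \<longlonglongrightarrow> 0"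
    by simp
  have "Cauchy p"
  proof (rule metric_CauchyI)
    fix e :: real assume "e > 0"
    then have "\<forall>\<^sub>F N in sequentially. 4 * ((D + 1 / (real N + 1))\<^sup>2 - D\<^sup>2) < e\<^sup>2"
      using order_tendstoD(2)[OF lim] by simp
    then obtain N where N: "4 * ((D + 1 / (real N + 1))\<^sup>2 - D\<^sup>2) < e\<^sup>2"
      by (auto simp: eventually_sequentially)
    have near: "dist y (p n) \<le> D + 1 / (real N + 1)" if "n \<ge> N" for n
    proof -
      have "1 / (real n + 1) \<le> 1 / (real N + 1)" using that by (simp add: frac_le)
      then show ?thesis using p(2)[of n] by linarith
    qed
    show "\<exists>M. \<forall>m\<ge>M. \<forall>n\<ge>M. dist (p m) (p n) < e"
      using gap[OF near near] N \<open>e > 0\<close>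
      by (meson less_eq_real_def order_le_less_trans power_less_imp_less_base)
  qed
  then obtain l where l: "p \<longlonglongrightarrow> l"
    using Cauchy_convergent convergent_def by blast
  have "l \<in> C" using C(2) p(1) l closed_sequentially by blast
  moreover have "dist y l \<le> D"
  proof (rule LIMSEQ_le)
    show "(\<lambda>n. dist y (p n)) \<longlonglongrightarrow> dist y l" using l by (intro tendsto_intros)
    show "(\<lambda>n. D + 1 / (real n + 1)) \<longlonglongrightarrow> D" using tendsto_add[OF tendsto_const small] by simp
    show "\<exists>N. \<forall>n\<ge>N. dist y (p n) \<le> D + 1 / (real n + 1)" using p(2) less_imp_le by blast
  qed
  ultimately show ?thesis using low order_trans by blast
qed

lemma
  fixes C :: "'a::{real_inner, complete_space} set"
  assumes C: "C \<noteq> {}" "closed C" "convex C"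
  shows metric_proj_in: "metric_proj C y \<in> C"
    and metric_proj_inner_le: "q \<in> C \<Longrightarrow> inner (y - metric_proj C y) (q - metric_proj C y) \<le> 0"
proof -
  obtain p where p: "p \<in> C" "\<forall>q\<in>C. dist y p \<le> dist y q"
    using metric_proj_exists[OF C] by blast
  have "metric_proj C y = p"
    unfolding metric_proj_def
    using p any_closest_point_unique[OF C(3,2)] by (intro the_equality) (auto simp: dist_norm)
  then show "metric_proj C y \<in> C"
      "q \<in> C \<Longrightarrow> inner (y - metric_proj C y) (q - metric_proj C y) \<le> 0"
    using p any_closest_point_dot[OF C(3,2)] by auto
qed

text \<open>Adding the obtuse-angle inequalities at both projections gives firm nonexpansiveness:
  the square of \<open>norm (?p - ?q)\<close> is at most \<open>inner (y - z) (?p - ?q)\<close>.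
  Cauchy-Schwarz then cancels one factor.\<close>

lemma metric_proj_nonexpansive:
  fixes C :: "'a::{real_inner, complete_space} set"
  assumes C: "C \<noteq> {}" "closed C" "convex C"
  shows "norm (metric_proj C y - metric_proj C z) \<le> norm (y - z)"
proof -
  let ?p = "metric_proj C y" and ?q = "metric_proj C z"
  have "(norm (?p - ?q))\<^sup>2 = inner (y - z) (?p - ?q) + inner (y - ?p) (?q - ?p) + inner (z - ?q) (?p - ?q)"
    unfolding power2_norm_eq_inner by (simp add: inner_diff_left inner_diff_right inner_commute)
  also have "\<dots> \<le> inner (y - z) (?p - ?q)"
    using metric_proj_inner_le[OF C metric_proj_in[OF C]] by (simp add: add_nonpos_nonpos)
  also have "\<dots> \<le> norm (y - z) * norm (?p - ?q)" by (rule norm_cauchy_schwarz)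
  finally show ?thesis
    by (cases "norm (?p - ?q) = 0") (simp_all add: power2_eq_square)
qed

section \<open>Scalar inequalities for the energy estimate\<close>

text \<open>
  Below, \<open>p\<close>, \<open>q\<close>, \<open>s\<close>, \<open>w\<close> are the norms of \<open>u\<^sub>k - x\<^sub>k\<close>, \<open>x\<^sub>k\<^sub>+\<^sub>1 - u\<^sub>k\<close>, \<open>x\<^sub>k - u\<^sub>k\<^sub>-\<^sub>1\<close>,
  \<open>u\<^sub>k\<^sub>-\<^sub>1 - x\<^sub>k\<^sub>-\<^sub>1\<close>, and \<open>v = \<beta>\<^sub>k w\<close>, so that \<open>16 v\<^sup>2 \<le> w\<^sup>2\<close>.
\<close>

lemma quadratic_form_bound:
  fixes p q s v :: real
  shows "2/5 * (p + s) * q + (p\<^sup>2 + q\<^sup>2) / 20 + 2/5 * q\<^sup>2 + 1/3 * p\<^sup>2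
     \<le> (p - v)\<^sup>2 + (q - v)\<^sup>2 + 2/5 * s\<^sup>2 + 16/3 * v\<^sup>2"
proof -
  \<comment> \<open>Completing the square in \<open>s\<close>, then in \<open>v\<close>, leaves a
    positive definite form in \<open>p\<close> and \<open>q\<close>; the ratio \<open>5/7\<close>
    keeps both remaining coefficients positive.\<close>
  have "(p - v)\<^sup>2 + (q - v)\<^sup>2 + 2/5 * s\<^sup>2 + 16/3 * v\<^sup>2
      - (2/5 * (p + s) * q + (p\<^sup>2 + q\<^sup>2) / 20 + 2/5 * q\<^sup>2 + 1/3 * p\<^sup>2)
    = 2/5 * (s - q/2)\<^sup>2 + 22/3 * (v - 3/22 * (p + q))\<^sup>2 + 259/550 * (p - 5/7 * q)\<^sup>2
      + 31/3300 * p\<^sup>2 + 113/1540 * q\<^sup>2"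
    by (simp add: power2_eq_square field_simps)
  also have "\<dots> \<ge> 0" by simp
  finally show ?thesis by simp
qed

text \<open>The bracket is the Lyapunov value, with \<open>r\<close> the distance of x_k to the
  solution and \<open>t\<close> the variational term. The factor 5 is the one in
  \<open>\<epsilon> k = 5 * \<beta> k\<close>.\<close>

lemma error_term_bound:
  fixes r s w t :: real
  assumes "t \<ge> 0"
  shows "2/5 * (r + s) * w \<le> 5 * (r\<^sup>2 + 2/5 * s\<^sup>2 + t + 1/3 * w\<^sup>2)"
proof -
  have "5 * (r\<^sup>2 + 2/5 * s\<^sup>2 + t + 1/3 * w\<^sup>2) - 2/5 * (r + s) * w
    = 1/5 * (r - w)\<^sup>2 + 1/5 * (s - w)\<^sup>2 + 24/5 * r\<^sup>2 + 9/5 * s\<^sup>2 + 19/15 * w\<^sup>2 + 5 * t"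
    by (simp add: power2_eq_square field_simps)
  also have "\<dots> \<ge> 0" using assms by simp
  finally show ?thesis by simp
qed

section \<open>Energy estimates for one iteration\<close>

text \<open>Pure inner-product algebra: the difference of the two sides is a nonnegative combination
  of \<open>P1a\<close>, \<open>P1b\<close>, \<open>P2\<close> and \<open>mono\<close>. Together
  \<open>P1a\<close> and \<open>P1b\<close> test the projection \<open>x1\<close> in the direction
  \<open>x2 - (2 *\<^sub>R x1 - x0)\<close>, measured from the unfiltered reflection. By
  \<open>u1\<close>, the two shifted vectors are \<open>x1 - x0\<close> and that same
  direction.\<close>

lemma projection_energy:
  fixes x0 x1 x2 u0 u1 b0 b1 bz z :: "'a::real_inner" and \<beta> lam :: real
  assumes P1a: "inner (x0 - lam *\<^sub>R b0 - x1) (x2 - x1) \<le> 0"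
    and P1b: "inner (x0 - lam *\<^sub>R b0 - x1) (x0 - x1) \<le> 0"
    and P2: "inner (x1 - lam *\<^sub>R b1 - x2) (z - x2) \<le> 0"
    and mono: "inner (b1 - bz) (u1 - z) \<ge> 0" and lam: "lam \<ge> 0"
    and u1: "u1 = x1 + (1 - \<beta>) *\<^sub>R (x1 - x0) + \<beta> *\<^sub>R (x1 - u0)"
  shows "(norm (x2 - z))\<^sup>2 + (norm ((u1 - x1) + \<beta> *\<^sub>R (u0 - x0)))\<^sup>2 + (norm ((x2 - u1) - \<beta> *\<^sub>R (u0 - x0)))\<^sup>2
    + 2 * lam * inner bz (2 *\<^sub>R x1 - x0 - z)
    \<le> (norm (x1 - z))\<^sup>2 + 2 * lam * inner (b1 - b0) (u1 - x2)
      - 2 * lam * \<beta> * inner (b0 - bz) (u0 - x0)"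
proof -
  have m: "lam * inner (b1 - bz) (u1 - z) \<ge> 0" using mono lam by simp
  have "(norm (x1 - z))\<^sup>2 + 2 * lam * inner (b1 - b0) (u1 - x2)
      - 2 * lam * \<beta> * inner (b0 - bz) (u0 - x0)
     - ((norm (x2 - z))\<^sup>2 + (norm ((u1 - x1) + \<beta> *\<^sub>R (u0 - x0)))\<^sup>2 + (norm ((x2 - u1) - \<beta> *\<^sub>R (u0 - x0)))\<^sup>2
      + 2 * lam * inner bz (2 *\<^sub>R x1 - x0 - z))
    = - 2 * inner (x0 - lam *\<^sub>R b0 - x1) (x2 - x1) - 2 * inner (x0 - lam *\<^sub>R b0 - x1) (x0 - x1)
      - 2 * inner (x1 - lam *\<^sub>R b1 - x2) (z - x2) + 2 * (lam * inner (b1 - bz) (u1 - z))"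
    unfolding u1 power2_norm_eq_inner
    by (simp add: inner_diff_left inner_diff_right inner_add_left inner_add_right inner_commute algebra_simps)
  then show ?thesis using P1a P1b P2 m by linarith
qed

text \<open>The decrease for k >= 1, with \<open>x0\<close>, \<open>x1\<close>, \<open>x2\<close> as
  x_{k-1}, x_k, x_{k+1} and \<open>u0\<close>, \<open>u1\<close> as u_{k-1}, u_k. Lipschitz
  continuity turns the operator cross term and the filter term of \<open>projection_energy\<close>
  into the scalar bounds above.\<close>

lemma lyapunov_step:
  fixes x0 x1 x2 u0 u1 z :: "'a::real_inner" and B :: "'a \<Rightarrow> 'a" and \<beta> lam L :: real
  assumes P1a: "inner (x0 - lam *\<^sub>R B u0 - x1) (x2 - x1) \<le> 0"
    and P1b: "inner (x0 - lam *\<^sub>R B u0 - x1) (x0 - x1) \<le> 0"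
    and P2: "inner (x1 - lam *\<^sub>R B u1 - x2) (z - x2) \<le> 0"
    and B: "monotone_operator B" "L-lipschitz_on UNIV B"
    and lam: "lam \<ge> 0" "lam * L = 1/5"
    and z: "inner (B z) (x0 - z) \<ge> 0" "inner (B z) (x1 - z) \<ge> 0"
    and \<beta>: "0 \<le> \<beta>" "\<beta> \<le> 1/4"
    and u1: "u1 = x1 + (1 - \<beta>) *\<^sub>R (x1 - x0) + \<beta> *\<^sub>R (x1 - u0)"
  defines "E \<equiv> (norm (x1 - z))\<^sup>2 + 2/5 * (norm (x1 - u0))\<^sup>2 + 2 * lam * inner (B z) (x0 - z)
        + 1/3 * (norm (u0 - x0))\<^sup>2"
  shows "(norm (x2 - z))\<^sup>2 + 2/5 * (norm (x2 - u1))\<^sup>2 + 2 * lam * inner (B z) (x1 - z)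
        + 1/3 * (norm (u1 - x1))\<^sup>2 + ((norm (u1 - x1))\<^sup>2 + (norm (x2 - u1))\<^sup>2) / 20
     \<le> E + 5 * \<beta> * E"
proof -
  define p q s w v where "p = norm (u1 - x1)" and "q = norm (x2 - u1)" and "s = norm (x1 - u0)"
    and "w = norm (u0 - x0)" and "v = \<beta> * w"
  define t where "t = 2 * lam * inner (B z) (x0 - z)"
  have lip: "norm (B y - B y') \<le> L * norm (y - y')" for y y'
    using lipschitz_onD[OF B(2), of y y'] by (simp add: dist_norm)
  have E: "E = (norm (x1 - z))\<^sup>2 + 2/5 * s\<^sup>2 + t + 1/3 * w\<^sup>2"
    by (simp add: E_def s_def t_def w_def)
  have "\<beta> * w = norm (\<beta> *\<^sub>R (u0 - x0))" using \<beta> by (simp add: w_def)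
  then have "\<bar>p - v\<bar> \<le> norm ((u1 - x1) + \<beta> *\<^sub>R (u0 - x0))"
      "\<bar>q - v\<bar> \<le> norm ((x2 - u1) - \<beta> *\<^sub>R (u0 - x0))"
    using norm_triangle_ineq3[of "u1 - x1" "- (\<beta> *\<^sub>R (u0 - x0))"]
      norm_triangle_ineq3[of "x2 - u1" "\<beta> *\<^sub>R (u0 - x0)"]
    by (simp_all add: p_def q_def v_def)
  then have sq: "(p - v)\<^sup>2 \<le> (norm ((u1 - x1) + \<beta> *\<^sub>R (u0 - x0)))\<^sup>2"
      "(q - v)\<^sup>2 \<le> (norm ((x2 - u1) - \<beta> *\<^sub>R (u0 - x0)))\<^sup>2"
    by (metis abs_ge_zero power2_abs power_mono)+
  have "inner (B u1 - B u0) (u1 - x2) \<le> norm (B u1 - B u0) * norm (u1 - x2)"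
    by (rule norm_cauchy_schwarz)
  also have "\<dots> \<le> (L * norm (u1 - u0)) * q"
    using lip by (simp add: q_def norm_minus_commute mult_right_mono)
  finally have "lam * inner (B u1 - B u0) (u1 - x2) \<le> lam * ((L * norm (u1 - u0)) * q)"
    using lam(1) by (rule mult_left_mono)
  also have "\<dots> = (lam * L) * norm (u1 - u0) * q" by simp
  also have "\<dots> \<le> 1/5 * (p + s) * q"
    unfolding lam(2) using norm_triangle_ineq[of "u1 - x1" "x1 - u0"]
    by (intro mult_right_mono mult_left_mono) (simp_all add: p_def s_def q_def)
  finally have cross: "2 * lam * inner (B u1 - B u0) (u1 - x2) \<le> 2/5 * (p + s) * q"
    by (simp add: algebra_simps)
  \<comment> \<open>The filter term costs at most \<open>\<beta>\<close> times \<open>5 * E\<close>,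
    because \<open>u0 - z = (x1 - z) - (x1 - u0)\<close> splits into vectors whose squared norms
    occur in \<open>E\<close>.\<close>
  have "- inner (B u0 - B z) (u0 - x0) \<le> norm (B u0 - B z) * norm (u0 - x0)"
    using Cauchy_Schwarz_ineq2[of "B u0 - B z" "u0 - x0"] by linarith
  also have "\<dots> \<le> (L * norm (u0 - z)) * w"
    using lip by (simp add: w_def mult_right_mono)
  finally have "lam * - inner (B u0 - B z) (u0 - x0) \<le> lam * ((L * norm (u0 - z)) * w)"
    using lam(1) by (rule mult_left_mono)
  also have "\<dots> = (lam * L) * norm (u0 - z) * w" by simp
  also have "\<dots> \<le> 1/5 * (norm (x1 - z) + s) * w"
    unfolding lam(2) using norm_triangle_ineq4[of "x1 - z" "x1 - u0"]
    by (intro mult_right_mono mult_left_mono) (simp_all add: s_def w_def)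
  finally have "- 2 * lam * inner (B u0 - B z) (u0 - x0) \<le> 2/5 * (norm (x1 - z) + s) * w"
    by (simp add: algebra_simps)
  also have "\<dots> \<le> 5 * E"
    unfolding E using z(1) lam(1) by (intro error_term_bound) (simp add: t_def)
  finally have "\<beta> * (- 2 * lam * inner (B u0 - B z) (u0 - x0)) \<le> \<beta> * (5 * E)"
    using \<beta>(1) by (rule mult_left_mono)
  then have err: "- 2 * lam * \<beta> * inner (B u0 - B z) (u0 - x0) \<le> 5 * \<beta> * E"
    by (simp add: mult_ac)
  have "v\<^sup>2 \<le> (w / 4)\<^sup>2"
    using \<beta> mult_right_mono[OF \<beta>(2), of w] by (intro power_mono) (auto simp: v_def w_def)
  then have vw: "16/3 * v\<^sup>2 \<le> 1/3 * w\<^sup>2" by (simp add: power_divide)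
  have "inner (B u1 - B z) (u1 - z) \<ge> 0" using B(1) by (simp add: monotone_operator_def)
  from projection_energy[OF P1a P1b P2 this lam(1) u1]
  have main: "(norm (x2 - z))\<^sup>2 + (p - v)\<^sup>2 + (q - v)\<^sup>2 + 2 * lam * inner (B z) (2 *\<^sub>R x1 - x0 - z)
      \<le> (norm (x1 - z))\<^sup>2 + 2/5 * (p + s) * q + 5 * \<beta> * E"
    using sq cross err by linarith
  \<comment> \<open>Since \<open>2 *\<^sub>R x1 - x0 - z\<close> is
    \<open>2 *\<^sub>R (x1 - z) - (x0 - z)\<close>, the variational term at \<open>x1\<close> occurs
    twice: one copy enters the new Lyapunov value, the other is nonnegative and dropped, and
    \<open>t\<close> is part of \<open>E\<close>.\<close>
  have "2 * lam * inner (B z) (2 *\<^sub>R x1 - x0 - z) = 4 * (lam * inner (B z) (x1 - z)) - t"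
    by (simp add: t_def inner_diff_right algebra_simps)
  moreover have "lam * inner (B z) (x1 - z) \<ge> 0" using z(2) lam(1) by simp
  ultimately show ?thesis
    using main quadratic_form_bound[of p s q v] vw
    unfolding p_def[symmetric] q_def[symmetric] E by linarith
qed

text \<open>Covers k = 0, where u_0 = x_0: with \<open>t\<close> the variational term common to a_0
  and a_1, this reads \<open>49 * a_1 + V_0^2 <= 90 * a_0\<close>. It rests on the projection
  inequality for \<open>x1\<close> tested at \<open>z\<close>.\<close>

lemma initial_step:
  fixes x0 x1 z :: "'a::real_inner" and B :: "'a \<Rightarrow> 'a" and lam L t :: real
  assumes P: "inner (x0 - lam *\<^sub>R B x0 - x1) (z - x1) \<le> 0"
    and B: "monotone_operator B" "L-lipschitz_on UNIV B"
    and lam: "lam \<ge> 0" "lam * L = 1/5"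
    and z: "inner (B z) (x1 - z) \<ge> 0" and t: "t \<ge> 0"
  shows "49 * ((norm (x1 - z))\<^sup>2 + 2/5 * (norm (x1 - x0))\<^sup>2 + t) + (norm (x1 - x0))\<^sup>2
    \<le> 90 * ((norm (x0 - z))\<^sup>2 + t)"
proof -
  define d r where "d = norm (x1 - x0)" and "r = norm (x0 - z)"
  have "inner (B x0 - B z) (x0 - x1) \<le> norm (B x0 - B z) * norm (x0 - x1)"
    by (rule norm_cauchy_schwarz)
  also have "\<dots> \<le> (L * r) * d"
    using lipschitz_onD[OF B(2), of x0 z]
    by (simp add: r_def d_def dist_norm norm_minus_commute mult_right_mono)
  finally have "lam * inner (B x0 - B z) (x0 - x1) \<le> lam * ((L * r) * d)"
    using lam(1) by (rule mult_left_mono)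
  also have "\<dots> = (lam * L) * (r * d)" by simp
  finally have cross: "lam * inner (B x0 - B z) (x0 - x1) \<le> 1/5 * (r * d)"
    by (simp only: lam(2))
  have "lam * inner (B x0 - B z) (x0 - z) \<ge> 0" "lam * inner (B z) (x1 - z) \<ge> 0"
    using B(1) z lam(1) by (simp_all add: monotone_operator_def)
  moreover have "(norm (x1 - z))\<^sup>2 + d\<^sup>2 = r\<^sup>2 + 2 * inner (x0 - lam *\<^sub>R B x0 - x1) (z - x1)
      + 2 * (lam * inner (B x0 - B z) (x0 - x1)) - 2 * (lam * inner (B x0 - B z) (x0 - z))
      - 2 * (lam * inner (B z) (x1 - z))"
    unfolding d_def r_def power2_norm_eq_inner
    by (simp add: inner_diff_left inner_diff_right inner_commute algebra_simps)
  ultimately have *: "(norm (x1 - z))\<^sup>2 + d\<^sup>2 \<le> r\<^sup>2 + 2/5 * (r * d)"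
    using P cross by linarith
  \<comment> \<open>Inserting \<open>*\<close> leaves this form as the surplus in \<open>r\<close>
    and \<open>d\<close>, with \<open>41 = 90 - 49\<close> and
    \<open>142/5 = 49 * 3/5 - 1\<close>.\<close>
  have "41 * r\<^sup>2 - 98/5 * (r * d) + 142/5 * d\<^sup>2 = 49/5 * (r - d)\<^sup>2 + 156/5 * r\<^sup>2 + 93/5 * d\<^sup>2"
    by (simp add: power2_eq_square field_simps)
  also have "\<dots> \<ge> 0" by simp
  finally have "0 \<le> 41 * r\<^sup>2 - 98/5 * (r * d) + 142/5 * d\<^sup>2" .
  then have "49 * ((norm (x1 - z))\<^sup>2 + 2/5 * d\<^sup>2 + t) + d\<^sup>2 \<le> 90 * (r\<^sup>2 + t)"
    using * t by argo
  then show ?thesis by (simp only: d_def r_def)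
qed

section \<open>Nearly decreasing sequences and tails of series\<close>

text \<open>Discrete Gronwall: \<open>1 + e k \<le> exp (e k)\<close> turns the product of growth
  factors into the exponential of a sum.\<close>

lemma perturbed_decreasing_bounded:
  fixes a e :: "nat \<Rightarrow> real"
  assumes step: "\<And>k. a (Suc k) \<le> a k + e k * a k"
    and nonneg: "\<And>k. a k \<ge> 0" "\<And>k. e k \<ge> 0" and e: "summable e"
  shows "a k \<le> a 0 * exp (suminf e)"
proof -
  have "a k \<le> a 0 * exp (\<Sum>i<k. e i)"
  proof (induction k)
    case (Suc k)
    have "a (Suc k) \<le> (1 + e k) * a k" using step[of k] by (simp add: algebra_simps)
    also have "\<dots> \<le> exp (e k) * (a 0 * exp (\<Sum>i<k. e i))"
      using Suc.IH nonneg by (intro mult_mono) auto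
    finally show ?case by (simp add: exp_add mult_ac)
  qed simp
  also have "\<dots> \<le> a 0 * exp (suminf e)"
    using nonneg e by (intro mult_left_mono) (auto intro: sum_le_suminf)
  finally show ?thesis .
qed

text \<open>Replacing \<open>e k * a k\<close> by \<open>A * e k\<close> makes the perturbation
  summable; telescoping then bounds all partial sums of \<open>d\<close>, as the final
  \<open>a n\<close> is nonnegative.\<close>

lemma perturbed_decreasing_suminf:
  fixes a d e :: "nat \<Rightarrow> real"
  assumes step: "\<And>k. a (Suc k) + d k \<le> a k + e k * a k"
    and nonneg: "\<And>k. a k \<ge> 0" "\<And>k. d k \<ge> 0" "\<And>k. e k \<ge> 0"
    and A: "\<And>k. a k \<le> A" and e: "summable e"
  shows "summable d" "suminf d \<le> a 0 + A * suminf e"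
proof -
  have partial: "a n + sum d {..<n} \<le> a 0 + A * sum e {..<n}" for n
  proof (induction n)
    case (Suc n)
    have "e n * a n \<le> A * e n"
      using mult_left_mono[OF A[of n] nonneg(3)[of n]] by (simp add: mult.commute)
    then show ?case using Suc step[of n] by (simp add: algebra_simps)
  qed simp
  have "A \<ge> 0" using A nonneg(1) order_trans by blast
  then have "A * sum e {..<n} \<le> A * suminf e" for n
    using nonneg(3) by (intro mult_left_mono sum_le_suminf[OF e]) simp_all
  then have bound: "sum d {..<n} \<le> a 0 + A * suminf e" for n
    using partial[of n] nonneg(1)[of n] by (meson add_increasing add_left_mono order_trans order_refl)
  show "summable d"
    using bound nonneg(2) by (intro summableI_nonneg_bounded)
  then show "suminf d \<le> a 0 + A * suminf e"
    using bound by (rule suminf_le_const)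
qed

text \<open>From the index where the bound starts, a tail is dominated by the geometric series with
  sum \<open>M * \<eta> ^ k / (1 - \<eta>)\<close>.\<close>

lemma suminf_tail_bigo_geometric:
  fixes f :: "nat \<Rightarrow> real"
  assumes "summable f" "f \<in> O(\<lambda>k. \<eta> ^ k)" "0 < \<eta>" "\<eta> < 1"
  shows "(\<lambda>k. \<Sum>j. f (j + k)) \<in> O(\<lambda>k. \<eta> ^ k)"
proof -
  obtain M where "\<forall>\<^sub>F k in sequentially. norm (f k) \<le> M * norm (\<eta> ^ k)"
    using assms(2) by (auto simp: bigo_def)
  then obtain N where N: "\<And>k. k \<ge> N \<Longrightarrow> \<bar>f k\<bar> \<le> M * \<eta> ^ k"
    using assms(3) by (auto simp: eventually_sequentially)
  have "\<bar>\<Sum>j. f (j + k)\<bar> \<le> M / (1 - \<eta>) * \<eta> ^ k" if "k \<ge> N" for k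
  proof -
    have geo: "(\<lambda>j. M * \<eta> ^ k * \<eta> ^ j) sums (M * \<eta> ^ k * (1 / (1 - \<eta>)))"
      using assms(3,4) by (intro sums_mult geometric_sums) simp
    have le: "norm (f (j + k)) \<le> M * \<eta> ^ k * \<eta> ^ j" for j
      using N[of "j + k"] that by (simp add: power_add mult_ac)
    have "norm (\<Sum>j. f (j + k)) \<le> (\<Sum>j. M * \<eta> ^ k * \<eta> ^ j)"
      by (rule norm_suminf_le[OF le sums_summable[OF geo]])
    then show ?thesis using geo by (simp add: sums_iff)
  qed
  then show ?thesis
    using assms(3) by (intro bigoI[of _ "M / (1 - \<eta>)"]) (auto simp: eventually_sequentially)
qed

section \<open>Convergence and tail estimates for the iteration\<close>

theorem corollary7p6:
  fixes C :: "'a::{real_inner, complete_space} set"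
    and B :: "'a \<Rightarrow> 'a"
    and L lam c A :: real
    and xs :: 'a
    and x u :: "nat \<Rightarrow> 'a"
    and \<beta> \<theta> a V r \<epsilon> :: "nat \<Rightarrow> real"
  assumes C: "C \<noteq> {}" "closed C" "convex C"
    and B: "monotone_operator B" "L-lipschitz_on UNIV B"
    and L: "L > 0"
    and lam: "lam = 1 / (5 * L)"
    and S: "vi_solutions C B = {xs}"
    and c: "c > 0"
    and error_bound:
      "\<forall>z\<in>C. infdist z (vi_solutions C B) \<le> c * norm (z - metric_proj C (z - lam *\<^sub>R B z))"
    and \<beta>: "\<forall>k. 0 \<le> \<beta> k \<and> \<beta> k \<le> 1 / 4" "summable \<beta>"
    and \<theta>: "\<forall>k. \<theta> k = 1 - \<beta> k"
    and init: "x 0 \<in> C" "u 0 = x 0"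
    and x_step: "\<forall>k. x (k + 1) = metric_proj C (x k - lam *\<^sub>R B (u k))"
    and u_step: "\<forall>k\<ge>1. u k = x k + \<theta> k *\<^sub>R (x k - x (k - 1)) + \<beta> k *\<^sub>R (x k - u (k - 1))"
    and V: "\<forall>k. V k = norm (x k - metric_proj C (x k - lam *\<^sub>R B (x k)))"
    and r: "\<forall>k. r k = norm (x k - xs)"
    and \<epsilon>: "\<forall>k. \<epsilon> k = 25 * lam * L * \<beta> k"
    and a: "\<forall>k. a k = lyapunov B L lam xs x u k"
    and A: "A = (SUP k. a k)"
  shows "x \<longlonglongrightarrow> xs
    \<and> bdd_above (range a)
    \<and> summable \<epsilon>
    \<and> summable (\<lambda>j. (V j)\<^sup>2)
    \<and> (\<forall>k. (\<Sum>j. (V (j + k))\<^sup>2) \<le> 90 * (a k + A * (\<Sum>j. \<epsilon> (j + k))))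
    \<and> (\<forall>k. r k \<le> c * V k)
    \<and> summable (\<lambda>j. (infdist (x j) (vi_solutions C B))\<^sup>2)
    \<and> (\<lambda>k. \<Sum>j. (infdist (x (j + k)) (vi_solutions C B))\<^sup>2)
        \<in> O(\<lambda>k. a k + (\<Sum>j. \<epsilon> (j + k)))
    \<and> (\<forall>\<eta>. 0 < \<eta> \<and> \<eta> < 1 \<and> \<beta> \<in> O(\<lambda>k. \<eta> ^ k) \<longrightarrow>
          (\<lambda>k. \<Sum>j. \<epsilon> (j + k)) \<in> O(\<lambda>k. \<eta> ^ k)
        \<and> (\<lambda>k. \<Sum>j. (infdist (x (j + k)) (vi_solutions C B))\<^sup>2) \<in> O(\<lambda>k. a k + \<eta> ^ k))"
proof -
  note proj = metric_proj_in[OF C] metric_proj_inner_le[OF C]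
  have lam0: "lam \<ge> 0" and lamL: "lam * L = 1/5" using L lam by simp_all
  have xs: "\<And>y. y \<in> C \<Longrightarrow> inner (B xs) (y - xs) \<ge> 0" "xs \<in> C"
    using S by (auto simp: vi_solutions_def)
  have xC: "x k \<in> C" for k
    using init(1) x_step proj(1) by (cases k) simp_all
  have x_Suc: "x (Suc k) = metric_proj C (x k - lam *\<^sub>R B (u k))" for k
    using x_step by simp
  have P: "inner (x k - lam *\<^sub>R B (u k) - x (Suc k)) (y - x (Suc k)) \<le> 0" if "y \<in> C" for k y
    unfolding x_Suc using that by (rule proj(2))
  have eps: "\<epsilon> k = 5 * \<beta> k" for k
    using \<epsilon> lamL by (simp add: mult.assoc)
  have eps0: "\<epsilon> k \<ge> 0" for k using eps \<beta>(1) by simp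
  have eps_sum: "summable \<epsilon>" unfolding eps[abs_def] by (rule summable_mult[OF \<beta>(2)])
  have aE: "a k = (norm (x k - xs))\<^sup>2 + 2/5 * (norm (x k - prev (x 0) u k))\<^sup>2
      + 2 * lam * inner (B xs) (prev (x 0) x k - xs)
      + 1/3 * (norm (prev (x 0) u k - prev (x 0) x k))\<^sup>2" for k
    using a lamL by (simp add: lyapunov_def mult.assoc)
  \<comment> \<open>The convention x_{-1} = x_0 puts the predecessor in \<open>C\<close> also at
    \<open>k = 0\<close>, so the variational term in \<open>a k\<close> is never negative.\<close>
  have prevC: "prev (x 0) x k \<in> C" for k using xC by (cases k) (simp_all add: prev_def)
  have a0: "a k \<ge> 0" for k
    unfolding aE using xs(1)[OF prevC] lam0 by simp
  define \<delta> where "\<delta> k = ((norm (u k - x k))\<^sup>2 + (norm (x (Suc k) - u k))\<^sup>2) / 20" for k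
  have \<delta>0: "\<delta> k \<ge> 0" for k by (simp add: \<delta>_def)
  \<comment> \<open>The index is shifted by one: the recursion for \<open>u\<close> and the
    projection formula for the current iterate hold from index 1 on.\<close>
  have step: "a (Suc (Suc k)) + \<delta> (Suc k) \<le> a (Suc k) + \<epsilon> (Suc k) * a (Suc k)" for k
  proof -
    have u: "u (Suc k) = x (Suc k) + (1 - \<beta> (Suc k)) *\<^sub>R (x (Suc k) - x k)
        + \<beta> (Suc k) *\<^sub>R (x (Suc k) - u k)"
      using u_step \<theta> by simp
    show ?thesis
      using lyapunov_step[OF P[OF xC] P[OF xC] P[OF xs(2)] B lam0 lamL xs(1)[OF xC] xs(1)[OF xC]
          _ _ u] \<beta>(1)
      by (simp add: aE prev_def \<delta>_def eps)
  qed
  \<comment> \<open>Passing through \<open>x (Suc k)\<close>, nonexpansiveness turns the change from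
    \<open>u k\<close> to \<open>x k\<close> inside \<open>B\<close> into \<open>p / 5\<close>.
    Cauchy-Schwarz bounds \<open>(6/5 * p + q)^2\<close> by \<open>61/25\<close> times
    \<open>p^2 + q^2\<close>, and \<open>49/20\<close> lies slightly above.\<close>
  have V_le: "(V k)\<^sup>2 \<le> 49 * \<delta> k" for k
  proof -
    define p q where "p = norm (u k - x k)" and "q = norm (x (Suc k) - u k)"
    have "V k \<le> norm (x k - x (Suc k)) + norm (x (Suc k) - metric_proj C (x k - lam *\<^sub>R B (x k)))"
      using V norm_triangle_ineq[of "x k - x (Suc k)" "x (Suc k) - metric_proj C (x k - lam *\<^sub>R B (x k))"]
      by simp
    also have "norm (x (Suc k) - metric_proj C (x k - lam *\<^sub>R B (x k)))
        \<le> norm ((x k - lam *\<^sub>R B (u k)) - (x k - lam *\<^sub>R B (x k)))"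
      unfolding x_Suc by (rule metric_proj_nonexpansive[OF C])
    also have "\<dots> = lam * norm (B (u k) - B (x k))"
      using lam0 by (simp add: norm_minus_commute flip: scaleR_diff_right)
    also have "\<dots> \<le> lam * (L * p)"
      using lipschitz_onD[OF B(2), of "u k" "x k"] lam0
      by (intro mult_left_mono) (simp_all add: p_def dist_norm)
    also have "\<dots> = 1/5 * p" using lamL by (simp flip: mult.assoc)
    also have "norm (x k - x (Suc k)) \<le> p + q"
      using norm_triangle_ineq[of "x k - u k" "u k - x (Suc k)"]
      by (simp add: p_def q_def norm_minus_commute)
    finally have "V k \<le> 6/5 * p + q" by simp
    then have "(V k)\<^sup>2 \<le> (6/5 * p + q)\<^sup>2" using V by (intro power_mono) simp_all
    also have "\<dots> = 49 * ((p\<^sup>2 + q\<^sup>2) / 20) - (p - 6/5 * q)\<^sup>2 - 1/100 * p\<^sup>2 - 1/100 * q\<^sup>2"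
      by (simp add: power2_eq_square field_simps)
    also have "\<dots> \<le> 49 * ((p\<^sup>2 + q\<^sup>2) / 20)"
      using zero_le_power2[of "p - 6/5 * q"] zero_le_power2[of p] zero_le_power2[of q] by linarith
    finally show ?thesis by (simp add: \<delta>_def p_def q_def)
  qed
  \<comment> \<open>Growth is controlled from index 1 on, hence the later maximum with
    \<open>a 0\<close>.\<close>
  have "a (Suc k) \<le> a (Suc 0) * exp (\<Sum>k. \<epsilon> (Suc k))" for k
  proof (rule perturbed_decreasing_bounded[of "\<lambda>k. a (Suc k)"])
    show "a (Suc (Suc k)) \<le> a (Suc k) + \<epsilon> (Suc k) * a (Suc k)" for k
      using step[of k] \<delta>0[of "Suc k"] by linarith
  qed (use a0 eps0 eps_sum summable_Suc_iff in auto)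
  then have "a k \<le> max (a 0) (a (Suc 0) * exp (\<Sum>k. \<epsilon> (Suc k)))" for k
    by (cases k) (simp_all add: le_max_iff_disj)
  then have bdd: "bdd_above (range a)" by (intro bdd_aboveI2)
  have aA: "a k \<le> A" for k unfolding A using bdd by (intro cSUP_upper UNIV_I)
  have A0: "A \<ge> 0" using a0 aA order_trans by blast
  have tail_Suc: "summable (\<lambda>j. \<delta> (j + Suc k))"
      "(\<Sum>j. \<delta> (j + Suc k)) \<le> a (Suc k) + A * (\<Sum>j. \<epsilon> (j + Suc k))" for k
  proof -
    have *: "a (Suc (j + Suc k)) + \<delta> (j + Suc k) \<le> a (j + Suc k) + \<epsilon> (j + Suc k) * a (j + Suc k)" for j
      using step[of "j + k"] by simp
    have e: "summable (\<lambda>j. \<epsilon> (j + Suc k))"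
      using eps_sum by (subst summable_iff_shift)
    show "summable (\<lambda>j. \<delta> (j + Suc k))"
      by (rule perturbed_decreasing_suminf(1)[where a = "\<lambda>j. a (j + Suc k)"])
        (use * e a0 \<delta>0 eps0 aA in auto)
    show "(\<Sum>j. \<delta> (j + Suc k)) \<le> a (Suc k) + A * (\<Sum>j. \<epsilon> (j + Suc k))"
      using perturbed_decreasing_suminf(2)[where a = "\<lambda>j. a (j + Suc k)"
          and d = "\<lambda>j. \<delta> (j + Suc k)" and e = "\<lambda>j. \<epsilon> (j + Suc k)" and A = A]
        * e a0 \<delta>0 eps0 aA by simp
  qed
  have \<delta>_sum: "summable \<delta>" using tail_Suc(1)[of 0] by (subst (asm) summable_iff_shift)
  have V_sum: "summable (\<lambda>j. (V j)\<^sup>2)"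
    using V_le by (intro summable_comparison_test'[OF summable_mult[OF \<delta>_sum, of 49]]) simp
  have tail0: "(\<Sum>j. \<epsilon> (j + k)) \<ge> 0" for k
    using eps0 eps_sum by (intro suminf_nonneg) (simp_all only: summable_iff_shift)
  have V_tail_Suc: "(\<Sum>j. (V (j + Suc k))\<^sup>2) \<le> 49 * (a (Suc k) + A * (\<Sum>j. \<epsilon> (j + Suc k)))" for k
  proof -
    have "(\<Sum>j. (V (j + Suc k))\<^sup>2) \<le> (\<Sum>j. 49 * \<delta> (j + Suc k))"
      using V_le V_sum tail_Suc(1)
      by (intro suminf_le summable_mult) (simp_all only: summable_iff_shift[of "\<lambda>j. (V j)\<^sup>2"])
    also have "\<dots> = 49 * (\<Sum>j. \<delta> (j + Suc k))" by (rule suminf_mult[OF tail_Suc(1)])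
    finally show ?thesis using tail_Suc(2)[of k] by simp
  qed
  have V_tail: "(\<Sum>j. (V (j + k))\<^sup>2) \<le> 90 * (a k + A * (\<Sum>j. \<epsilon> (j + k)))" for k
  proof (cases k)
    \<comment> \<open>The head \<open>V 0\<close> is split off: \<open>u 0 = x 0\<close> makes it
      \<open>norm (x (Suc 0) - x 0)\<close>, so \<open>initial_step\<close> absorbs its square
      together with \<open>49 * a (Suc 0)\<close> into \<open>90 * a 0\<close>.\<close>
    case 0
    have first: "inner (x 0 - lam *\<^sub>R B (x 0) - x (Suc 0)) (xs - x (Suc 0)) \<le> 0"
      using P[OF xs(2), of 0] init(2) by simp
    have "2 * lam * inner (B xs) (x 0 - xs) \<ge> 0" using xs(1)[OF xC] lam0 by simp
    from initial_step[OF first B lam0 lamL xs(1)[OF xC] this]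
    have "49 * a (Suc 0) + (norm (x (Suc 0) - x 0))\<^sup>2 \<le> 90 * a 0"
      using init(2) by (simp add: aE prev_def)
    moreover have "(V 0)\<^sup>2 = (norm (x (Suc 0) - x 0))\<^sup>2"
      using V x_Suc[of 0] init(2) by (simp add: norm_minus_commute)
    moreover have "(\<Sum>j. (V j)\<^sup>2) = (V 0)\<^sup>2 + (\<Sum>j. (V (j + Suc 0))\<^sup>2)"
      using suminf_split_head[OF V_sum] by simp
    moreover have "A * (\<Sum>j. \<epsilon> (j + Suc 0)) \<le> A * (\<Sum>j. \<epsilon> j)"
      using suminf_split_head[OF eps_sum] eps0[of 0] A0 by (intro mult_left_mono) simp_all
    moreover have "A * (\<Sum>j. \<epsilon> (j + Suc 0)) \<ge> 0" using A0 tail0[of "Suc 0"] by simp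
    ultimately show ?thesis using V_tail_Suc[of 0] unfolding 0 add_0_right distrib_left by linarith
  next
    case (Suc m)
    have "A * (\<Sum>j. \<epsilon> (j + Suc m)) \<ge> 0" using A0 tail0[of "Suc m"] by simp
    then show ?thesis using V_tail_Suc[of m] a0[of "Suc m"] unfolding Suc distrib_left by linarith
  qed
  have rV: "r k \<le> c * V k" for k
    using error_bound[rule_format, OF xC[of k]] S r V by (simp add: dist_norm)
  have dist_r: "infdist (x j) (vi_solutions C B) = r j" for j
    using S r by (simp add: dist_norm)
  have r_sq: "(r j)\<^sup>2 \<le> c\<^sup>2 * (V j)\<^sup>2" for j
    using power_mono[OF rV, of j 2] r by (simp add: power_mult_distrib)
  have r_sum: "summable (\<lambda>j. (r j)\<^sup>2)"
    using r_sq by (intro summable_comparison_test'[OF summable_mult[OF V_sum, of "c\<^sup>2"]]) simp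
  have r_tail: "(\<Sum>j. (r (j + k))\<^sup>2) \<le> c\<^sup>2 * 90 * max 1 A * (a k + (\<Sum>j. \<epsilon> (j + k)))" for k
  proof -
    have sV: "summable (\<lambda>j. (V (j + k))\<^sup>2)" and sr: "summable (\<lambda>j. (r (j + k))\<^sup>2)"
      using V_sum r_sum by (simp_all only: summable_iff_shift[of "\<lambda>j. (V j)\<^sup>2"]
          summable_iff_shift[of "\<lambda>j. (r j)\<^sup>2"])
    have "(\<Sum>j. (r (j + k))\<^sup>2) \<le> (\<Sum>j. c\<^sup>2 * (V (j + k))\<^sup>2)"
      using r_sq by (intro suminf_le sr summable_mult sV)
    also have "\<dots> = c\<^sup>2 * (\<Sum>j. (V (j + k))\<^sup>2)" by (rule suminf_mult[OF sV])
    also have "\<dots> \<le> c\<^sup>2 * (90 * (a k + A * (\<Sum>j. \<epsilon> (j + k))))"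
      by (intro mult_left_mono V_tail) simp
    \<comment> \<open>\<open>A\<close> may be below 1, so \<open>max 1 A\<close> serves as the
      common coefficient of both summands.\<close>
    also have "\<dots> \<le> c\<^sup>2 * (90 * (max 1 A * a k + max 1 A * (\<Sum>j. \<epsilon> (j + k))))"
      using mult_right_mono[of 1 "max 1 A" "a k"] mult_right_mono[of A "max 1 A"] a0[of k] tail0[of k]
      by (intro mult_left_mono add_mono) simp_all
    finally show ?thesis by (simp add: algebra_simps)
  qed
  have bigo: "(\<lambda>k. \<Sum>j. (r (j + k))\<^sup>2) \<in> O(\<lambda>k. a k + (\<Sum>j. \<epsilon> (j + k)))"
  proof (rule bigoI[OF always_eventually], rule allI)
    fix k
    have "(\<Sum>j. (r (j + k))\<^sup>2) \<ge> 0"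
      using r_sum by (intro suminf_nonneg) (simp_all only: summable_iff_shift[of "\<lambda>j. (r j)\<^sup>2"] zero_le_power2)
    then show "norm (\<Sum>j. (r (j + k))\<^sup>2) \<le> c\<^sup>2 * 90 * max 1 A * norm (a k + (\<Sum>j. \<epsilon> (j + k)))"
      using r_tail[of k] a0[of k] tail0[of k] by simp
  qed
  \<comment> \<open>Strong convergence comes directly from summability: by the error bound the
    squared distances to the only solution are summable, so they tend to zero.\<close>
  have "(\<lambda>j. (r j)\<^sup>2) \<longlonglongrightarrow> 0" by (rule summable_LIMSEQ_zero[OF r_sum])
  from tendsto_real_sqrt[OF this] have "(\<lambda>j. norm (x j - xs)) \<longlonglongrightarrow> 0"
    using r by simp
  then have conv: "x \<longlonglongrightarrow> xs" by (simp add: tendsto_norm_zero_iff LIM_zero_iff)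
  have geom: "(\<lambda>k. \<Sum>j. \<epsilon> (j + k)) \<in> O(\<lambda>k. \<eta> ^ k)
      \<and> (\<lambda>k. \<Sum>j. (r (j + k))\<^sup>2) \<in> O(\<lambda>k. a k + \<eta> ^ k)"
    if "0 < \<eta> \<and> \<eta> < 1 \<and> \<beta> \<in> O(\<lambda>k. \<eta> ^ k)" for \<eta>
  proof
    have "\<epsilon> \<in> O(\<lambda>k. \<eta> ^ k)" using that by (simp add: eps[abs_def])
    then show tail: "(\<lambda>k. \<Sum>j. \<epsilon> (j + k)) \<in> O(\<lambda>k. \<eta> ^ k)"
      using that eps_sum by (intro suminf_tail_bigo_geometric) simp_all
    \<comment> \<open>Both summands are nonnegative, so each is dominated by their sum.\<close>
    have dom: "a \<in> O(\<lambda>k. a k + \<eta> ^ k)" "(\<lambda>k. \<eta> ^ k) \<in> O(\<lambda>k. a k + \<eta> ^ k)"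
      using a0 that by (auto intro!: bigoI[of _ 1] always_eventually)
    have "(\<lambda>k. a k + (\<Sum>j. \<epsilon> (j + k))) \<in> O(\<lambda>k. a k + \<eta> ^ k)"
      by (rule sum_in_bigo(1)[OF dom(1) landau_o.big_trans[OF tail dom(2)]])
    then show "(\<lambda>k. \<Sum>j. (r (j + k))\<^sup>2) \<in> O(\<lambda>k. a k + \<eta> ^ k)"
      using bigo landau_o.big_trans by blast
  qed
  show ?thesis
    unfolding dist_r using conv bdd eps_sum V_sum V_tail rV r_sum bigo geom by blast
qed

end
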